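(* Let $c,\phi\in\mathbb{R}$ with $\phi\neq0$, and let $H(s)$ be a continuous function on an interval in $(0,\infty)$ containing $s_0$. Then there exists a 2-parameter family of pseudo-isotropic helicoidal surfaces of i-type in $\mathbb{I}^3_{\mathrm{p}}$ with $H$ as the mean curvature (i.e. the mean curvature at the point with parameters $(s,t)$ is $H(s)$) and whose generating curves $\alpha_{h_0,h_1}(s)=(s,0,z(s))$, or $\alpha_{h_0,h_1}(s)=(0,s,z(s))$, where $s>0$ is an arc-length parameter, satisfy $$z(s)=h_0+h_1\ln s+\varepsilon\int_{s_0}^{s}\left(\frac{2}{v}\int_{s_0}^{v}w\,H(w)\,dw\right)dv,$$ where $h_0,h_1$ are constants depending on the values of $z,z'$ at $s=s_0$ and $\varepsilon=\pm1$ determines the causal character of the generating curves: $\varepsilon=+1$ for $(s,0,z(s))$ (spacelike) and $\varepsilon=-1$ for $(0,s,z(s))$ (timelike). (The assertion holds for each of the two kinds of generating curve.)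
   Context: The pseudo-isotropic space $\mathbb{I}^3_{\mathrm{p}}$ is $\mathbb{R}^3$ with the degenerate metric $\langle u,v\rangle_{pz}=u^1v^1-u^2v^2$. For a $C^2$ parameterized surface $\mathbf{x}(u^1,u^2)=(x^1,x^2,x^3)$ write $\mathbf{x}_i=\partial\mathbf{x}/\partial u^i$, $\mathbf{x}_{ij}=\partial^2\mathbf{x}/\partial u^i\partial u^j$, $x^i_k=\partial x^i/\partial u^k$, $X_{ij}=x^i_1x^j_2-x^j_1x^i_2$. The surface is admissible if $X_{12}\neq0$ (equivalently, the induced metric has rank 2). Put $g_{ij}=\langle\mathbf{x}_i,\mathbf{x}_j\rangle_{pz}$, $N_h=\left(\frac{X_{23}}{X_{12}},\frac{X_{13}}{X_{12}},1\right)$, $h_{ij}=\langle N_h,\mathbf{x}_{ij}\rangle_1$, where $\langle u,v\rangle_1=u^1v^1-u^2v^2+u^3v^3$. The Gaussian and mean curvatures are $$K=\frac{h_{11}h_{22}-h_{12}^2}{g_{11}g_{22}-g_{12}^2},\qquad H=\frac12\,\frac{g_{11}h_{22}-2g_{12}h_{12}+g_{22}h_{11}}{g_{11}g_{22}-g_{12}^2};$$ equivalently $K=\det L$, $H=\frac12\mathrm{tr}\,L$ with $L=-D\xi^{\mathrm p}$, $\xi^{\mathrm p}=\left(A,B,\frac12(1-A^2+B^2)\right)$, $A=X_{23}/X_{12}$, $B=X_{13}/X_{12}$. The helicoidal surfaces of i-type with parameters $c,\phi$ are, with coordinates $(u^1,u^2)=(u,t)$ and $C^2$ generating curve $\alpha$: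 for $\alpha(u)=(x(u),0,z(u))$ (spacelike), $$Zh_2(u,t)=(x(u)\cosh(t\phi),\ x(u)\sinh(t\phi),\ z(u)+ct),$$ and for $\alpha(u)=(0,y(u),z(u))$ (timelike), $$Wh_2(u,t)=(y(u)\sinh(t\phi),\ y(u)\cosh(t\phi),\ z(u)+ct).$$ Surfaces are assumed admissible, i.e. $\phi xx'\neq0$, respectively $\phi yy'\neq0$. *)

theory Defs
  imports "HOL-Analysis.Analysis"
begin

text \<open>
  A vector of the pseudo-isotropic space is an element of \<open>real^3\<close>.  A parametrized surface
  on a parameter domain \<open>U \<subseteq> real \<times> real\<close> is a curried function \<open>real \<Rightarrow> real \<Rightarrow> real^3\<close>.
  All derivatives are taken within the parameter domain: at interior points they are the
  usual ones, at an endpoint of an interval they are one-sided.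
\<close>

definition pz_inner :: "real^3 \<Rightarrow> real^3 \<Rightarrow> real" where
  "pz_inner u v = u$1 * v$1 - u$2 * v$2"

definition inner_1 :: "real^3 \<Rightarrow> real^3 \<Rightarrow> real" where
  "inner_1 u v = u$1 * v$1 - u$2 * v$2 + u$3 * v$3"


subsection \<open>Curves\<close>

definition curve_deriv :: "real set \<Rightarrow> (real \<Rightarrow> 'a::real_normed_vector) \<Rightarrow> real \<Rightarrow> 'a" where
  "curve_deriv I \<alpha> s = vector_derivative \<alpha> (at s within I)"

definition C2_curve :: "real set \<Rightarrow> (real \<Rightarrow> 'a::real_normed_vector) \<Rightarrow> bool" where
  "C2_curve I \<alpha> \<longleftrightarrow> \<alpha> differentiable_on I \<and> curve_deriv I \<alpha> differentiable_on I \<and>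
     continuous_on I (curve_deriv I (curve_deriv I \<alpha>))"

definition spacelike_on :: "real set \<Rightarrow> (real \<Rightarrow> real^3) \<Rightarrow> bool" where
  "spacelike_on I \<alpha> \<longleftrightarrow> (\<forall>s\<in>I. pz_inner (curve_deriv I \<alpha> s) (curve_deriv I \<alpha> s) > 0)"

definition timelike_on :: "real set \<Rightarrow> (real \<Rightarrow> real^3) \<Rightarrow> bool" where
  "timelike_on I \<alpha> \<longleftrightarrow> (\<forall>s\<in>I. pz_inner (curve_deriv I \<alpha> s) (curve_deriv I \<alpha> s) < 0)"

definition arc_length_parametrized_on :: "real set \<Rightarrow> (real \<Rightarrow> real^3) \<Rightarrow> bool" where
  "arc_length_parametrized_on I \<alpha> \<longleftrightarrow>
     (\<forall>s\<in>I. \<bar>pz_inner (curve_deriv I \<alpha> s) (curve_deriv I \<alpha> s)\<bar> = 1)"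


subsection \<open>Surfaces\<close>

text \<open>The partial derivative with respect to the first (\<open>i = 1\<close>) or second (\<open>i = 2\<close>) parameter.\<close>

definition partial ::
  "(real \<times> real) set \<Rightarrow> 2 \<Rightarrow> (real \<Rightarrow> real \<Rightarrow> real^3) \<Rightarrow> real \<Rightarrow> real \<Rightarrow> real^3" where
  "partial U i X u v =
     (if i = 1 then vector_derivative (\<lambda>r. X r v) (at u within {r. (r, v) \<in> U})
      else vector_derivative (\<lambda>r. X u r) (at v within {r. (u, r) \<in> U}))"

definition has_partial ::
  "(real \<times> real) set \<Rightarrow> 2 \<Rightarrow> (real \<Rightarrow> real \<Rightarrow> real^3) \<Rightarrow> real \<Rightarrow> real \<Rightarrow> bool" where
  "has_partial U i X u v \<longleftrightarrow>
     (if i = 1 then (\<lambda>r. X r v) differentiable (at u within {r. (r, v) \<in> U})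
      else (\<lambda>r. X u r) differentiable (at v within {r. (u, r) \<in> U}))"

definition C1_surface :: "(real \<times> real) set \<Rightarrow> (real \<Rightarrow> real \<Rightarrow> real^3) \<Rightarrow> bool" where
  "C1_surface U X \<longleftrightarrow> continuous_on U (\<lambda>(u, v). X u v) \<and>
     (\<forall>i. (\<forall>(u, v)\<in>U. has_partial U i X u v) \<and> continuous_on U (\<lambda>(u, v). partial U i X u v))"

definition C2_surface :: "(real \<times> real) set \<Rightarrow> (real \<Rightarrow> real \<Rightarrow> real^3) \<Rightarrow> bool" where
  "C2_surface U X \<longleftrightarrow> C1_surface U X \<and> (\<forall>i. C1_surface U (partial U i X))"

definition X_minor ::
  "(real \<times> real) set \<Rightarrow> (real \<Rightarrow> real \<Rightarrow> real^3) \<Rightarrow> 3 \<Rightarrow> 3 \<Rightarrow> real \<Rightarrow> real \<Rightarrow> real" where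
  "X_minor U X i j u v =
     partial U 1 X u v $ i * partial U 2 X u v $ j - partial U 1 X u v $ j * partial U 2 X u v $ i"

definition admissible :: "(real \<times> real) set \<Rightarrow> (real \<Rightarrow> real \<Rightarrow> real^3) \<Rightarrow> bool" where
  "admissible U X \<longleftrightarrow> (\<forall>(u, v)\<in>U. X_minor U X 1 2 u v \<noteq> 0)"

definition g_form ::
  "(real \<times> real) set \<Rightarrow> (real \<Rightarrow> real \<Rightarrow> real^3) \<Rightarrow> 2 \<Rightarrow> 2 \<Rightarrow> real \<Rightarrow> real \<Rightarrow> real" where
  "g_form U X i j u v = pz_inner (partial U i X u v) (partial U j X u v)"

definition N_h ::
  "(real \<times> real) set \<Rightarrow> (real \<Rightarrow> real \<Rightarrow> real^3) \<Rightarrow> real \<Rightarrow> real \<Rightarrow> real^3" where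
  "N_h U X u v = vector [X_minor U X 2 3 u v / X_minor U X 1 2 u v,
                         X_minor U X 1 3 u v / X_minor U X 1 2 u v, 1]"

definition h_form ::
  "(real \<times> real) set \<Rightarrow> (real \<Rightarrow> real \<Rightarrow> real^3) \<Rightarrow> 2 \<Rightarrow> 2 \<Rightarrow> real \<Rightarrow> real \<Rightarrow> real" where
  "h_form U X i j u v = inner_1 (N_h U X u v) (partial U j (partial U i X) u v)"

definition mean_curvature ::
  "(real \<times> real) set \<Rightarrow> (real \<Rightarrow> real \<Rightarrow> real^3) \<Rightarrow> real \<Rightarrow> real \<Rightarrow> real" where
  "mean_curvature U X u v =
     1 / 2 * ((g_form U X 1 1 u v * h_form U X 2 2 u v - 2 * g_form U X 1 2 u v * h_form U X 1 2 u v
               + g_form U X 2 2 u v * h_form U X 1 1 u v)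
              / (g_form U X 1 1 u v * g_form U X 2 2 u v - (g_form U X 1 2 u v)\<^sup>2))"


subsection \<open>Helicoidal surfaces of i-type\<close>

definition Zh2 :: "real \<Rightarrow> real \<Rightarrow> (real \<Rightarrow> real^3) \<Rightarrow> real \<Rightarrow> real \<Rightarrow> real^3" where
  "Zh2 c \<phi> \<alpha> u t = vector [\<alpha> u $ 1 * cosh (t * \<phi>), \<alpha> u $ 1 * sinh (t * \<phi>), \<alpha> u $ 3 + c * t]"

definition Wh2 :: "real \<Rightarrow> real \<Rightarrow> (real \<Rightarrow> real^3) \<Rightarrow> real \<Rightarrow> real \<Rightarrow> real^3" where
  "Wh2 c \<phi> \<alpha> u t = vector [\<alpha> u $ 2 * sinh (t * \<phi>), \<alpha> u $ 2 * cosh (t * \<phi>), \<alpha> u $ 3 + c * t]"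

text \<open>
  The admissible \<open>C\<^sup>2\<close> helicoidal surfaces with generating curve \<open>\<alpha> = (x, 0, z)\<close> (spacelike),
  respectively \<open>\<alpha> = (0, y, z)\<close> (timelike); the angle parameter \<open>t\<close> ranges over all reals.
\<close>

definition spacelike_helicoidal ::
  "real \<Rightarrow> real \<Rightarrow> real set \<Rightarrow> (real \<Rightarrow> real^3) \<Rightarrow> (real \<Rightarrow> real \<Rightarrow> real^3) \<Rightarrow> bool" where
  "spacelike_helicoidal c \<phi> I \<alpha> X \<longleftrightarrow>
     (\<forall>s\<in>I. \<alpha> s $ 2 = 0) \<and> C2_curve I \<alpha> \<and> spacelike_on I \<alpha> \<and>
     (\<forall>s\<in>I. \<forall>t. X s t = Zh2 c \<phi> \<alpha> s t) \<and>
     C2_surface (I \<times> UNIV) X \<and> admissible (I \<times> UNIV) X"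

definition timelike_helicoidal ::
  "real \<Rightarrow> real \<Rightarrow> real set \<Rightarrow> (real \<Rightarrow> real^3) \<Rightarrow> (real \<Rightarrow> real \<Rightarrow> real^3) \<Rightarrow> bool" where
  "timelike_helicoidal c \<phi> I \<alpha> X \<longleftrightarrow>
     (\<forall>s\<in>I. \<alpha> s $ 1 = 0) \<and> C2_curve I \<alpha> \<and> timelike_on I \<alpha> \<and>
     (\<forall>s\<in>I. \<forall>t. X s t = Wh2 c \<phi> \<alpha> s t) \<and>
     C2_surface (I \<times> UNIV) X \<and> admissible (I \<times> UNIV) X"

end

theory Submission imports Defs begin

text \<open>
  Both kinds of helicoidal surface have the form
  \<open>X(u, t) = (u p(t), u q(t), z(u) + c t)\<close> with \<open>p' = \<phi> q\<close>, \<open>q' = \<phi> p\<close> and \<open>p\<^sup>2 - q\<^sup>2 = \<epsilon>\<close>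
  constant: \<open>(p, q) = (cosh, sinh)\<close> for the spacelike generating curve (\<open>\<epsilon> = 1\<close>) and
  \<open>(sinh, cosh)\<close> for the timelike one (\<open>\<epsilon> = -1\<close>).  These three relations are all that the
  curvature computation uses, so it is done once.  They make the first fundamental form
  diagonal with entries \<open>\<epsilon>\<close> and \<open>-\<epsilon> \<phi>\<^sup>2 u\<^sup>2\<close>, while \<open>h\<^sub>1\<^sub>1 = z''\<close> and \<open>h\<^sub>2\<^sub>2 = -\<phi>\<^sup>2 u z'\<close>; hence
  \<open>2 H = \<epsilon> (z'' + z' / u) = \<epsilon> (u z')' / u\<close> (lemma \<open>mean_curvature_hyperbolic_screw\<close>).

  Prescribing \<open>H\<close> is therefore the linear equation \<open>(u z')' = 2 \<epsilon> u H\<close>, which two integrations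
  solve: \<open>u z'(u) = h\<^sub>1 + 2 \<epsilon> \<integral> w H(w) dw\<close>, and then \<open>z\<close> itself.  Continuity of \<open>H\<close> is exactly
  what lets the fundamental theorem of calculus give a \<open>C\<^sup>2\<close> profile.  As both integrals vanish at
  \<open>s\<^sub>0\<close>, the constants are recovered from \<open>z'(s\<^sub>0) = h\<^sub>1 / s\<^sub>0\<close> and
  \<open>z(s\<^sub>0) = h\<^sub>0 + h\<^sub>1 ln s\<^sub>0\<close>.
\<close>

section \<open>Vectors given by their three coordinates\<close>

text \<open>This expansion turns calculus of such vectors into the usual rules for sums and scalings.\<close>

lemma vector_3_axis:
  "(vector [a, b, c] :: real^3) = a *\<^sub>R axis 1 1 + b *\<^sub>R axis 2 1 + c *\<^sub>R axis 3 1"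
  by (simp add: vec_eq_iff forall_3 axis_def)

lemma continuous_on_vector_3 [continuous_intros]:
  fixes f g h :: "'a::topological_space \<Rightarrow> real"
  assumes "continuous_on S f" "continuous_on S g" "continuous_on S h"
  shows "continuous_on S (\<lambda>x. vector [f x, g x, h x] :: real^3)"
  unfolding vector_3_axis using assms by (intro continuous_intros)

lemma has_vector_derivative_vector_3:
  assumes "(f has_real_derivative f') (at x within S)"
    and "(g has_real_derivative g') (at x within S)"
    and "(h has_real_derivative h') (at x within S)"
  shows "((\<lambda>x. vector [f x, g x, h x] :: real^3) has_vector_derivative vector [f', g', h'])
           (at x within S)"
  unfolding vector_3_axis
  using assms
  by (auto intro!: derivative_eq_intros)


section \<open>Derivatives on intervals and on strips\<close>

lemma interval_at_within_nontrivial: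
  fixes I :: "real set"
  assumes "is_interval I" "interior I \<noteq> {}" "u \<in> I"
  shows "at u within I \<noteq> bot"
proof -
  have "\<nexists>x. I = {x}"
    using assms(2) by auto
  then have "u islimpt I"
    using assms connected_imp_perfect is_interval_connected by blast
  then show ?thesis
    by (simp add: trivial_limit_within)
qed

lemma curve_deriv_eq:
  assumes "at s within I \<noteq> bot" "(\<alpha> has_vector_derivative d) (at s within I)"
  shows "curve_deriv I \<alpha> s = d"
  unfolding curve_deriv_def using assms by (rule vector_derivative_within)

lemma C2_curveI:
  assumes nt: "\<And>s. s \<in> I \<Longrightarrow> at s within I \<noteq> bot"
    and d1: "\<And>s. s \<in> I \<Longrightarrow> (\<alpha> has_vector_derivative \<alpha>' s) (at s within I)"
    and d2: "\<And>s. s \<in> I \<Longrightarrow> (\<alpha>' has_vector_derivative \<alpha>'' s) (at s within I)"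
    and cont: "continuous_on I \<alpha>''"
  shows "C2_curve I \<alpha>"
proof -
  have eq1: "curve_deriv I \<alpha> s = \<alpha>' s" if "s \<in> I" for s
    using nt d1 that by (auto intro: curve_deriv_eq)
  have d2': "(curve_deriv I \<alpha> has_vector_derivative \<alpha>'' s) (at s within I)" if "s \<in> I" for s
    using has_vector_derivative_transform[OF that eq1 d2[OF that]] by blast
  have "curve_deriv I (curve_deriv I \<alpha>) s = \<alpha>'' s" if "s \<in> I" for s
    using nt d2' that by (auto intro: curve_deriv_eq)
  then have "continuous_on I (curve_deriv I (curve_deriv I \<alpha>))"
    using cont by (simp cong: continuous_on_cong)
  then show ?thesis
    unfolding C2_curve_def differentiable_on_def
    using d1 d2' by (auto intro: differentiableI_vector)
qed

text \<open>
  Differentiation within \<open>I\<close> sees only values over \<open>I\<close>.  This is needed for second partials: the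
  first partials are known in closed form over \<open>I\<close> only.
\<close>

lemma partial_strip_cong:
  assumes "\<And>u t. u \<in> I \<Longrightarrow> X u t = Y u t" "u \<in> I"
  shows "partial (I \<times> UNIV) i X u t = partial (I \<times> UNIV) i Y u t"
    and "has_partial (I \<times> UNIV) i X u t \<longleftrightarrow> has_partial (I \<times> UNIV) i Y u t"
proof -
  have v: "((\<lambda>r. X r t) has_vector_derivative d) (at u within I) \<longleftrightarrow>
        ((\<lambda>r. Y r t) has_vector_derivative d) (at u within I)" for d
    using assms has_vector_derivative_transform[of u I "\<lambda>r. X r t" "\<lambda>r. Y r t"]
      has_vector_derivative_transform[of u I "\<lambda>r. Y r t" "\<lambda>r. X r t"] by auto
  then have "vector_derivative (\<lambda>r. X r t) (at u within I) =
        vector_derivative (\<lambda>r. Y r t) (at u within I)"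
    by (simp add: vector_derivative_def)
  moreover have "X u = Y u"
    using assms by auto
  ultimately show "partial (I \<times> UNIV) i X u t = partial (I \<times> UNIV) i Y u t"
    using assms(2) by (simp add: partial_def)
  have "(\<lambda>r. X r t) differentiable (at u within I) \<longleftrightarrow>
      (\<lambda>r. Y r t) differentiable (at u within I)"
    using v by (meson differentiableI_vector vector_derivative_works)
  then show "has_partial (I \<times> UNIV) i X u t \<longleftrightarrow> has_partial (I \<times> UNIV) i Y u t"
    using assms(2) \<open>X u = Y u\<close> by (simp add: has_partial_def)
qed

lemma C1_surface_strip_cong:
  assumes "\<And>u t. u \<in> I \<Longrightarrow> X u t = Y u t"
  shows "C1_surface (I \<times> UNIV) X \<longleftrightarrow> C1_surface (I \<times> UNIV) Y"
proof -
  have "continuous_on (I \<times> UNIV) (\<lambda>(u, v). X u v) \<longleftrightarrow>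
      continuous_on (I \<times> UNIV) (\<lambda>(u, v). Y u v)"
    using assms by (intro continuous_on_cong) auto
  moreover have "continuous_on (I \<times> UNIV) (\<lambda>(u, v). partial (I \<times> UNIV) i X u v) \<longleftrightarrow>
      continuous_on (I \<times> UNIV) (\<lambda>(u, v). partial (I \<times> UNIV) i Y u v)" for i
    using partial_strip_cong(1)[OF assms] by (intro continuous_on_cong) auto
  moreover have "(\<forall>(u, v)\<in>I \<times> UNIV. has_partial (I \<times> UNIV) i X u v) \<longleftrightarrow>
      (\<forall>(u, v)\<in>I \<times> UNIV. has_partial (I \<times> UNIV) i Y u v)" for i
    using partial_strip_cong(2)[OF assms] by auto
  ultimately show ?thesis
    by (simp add: C1_surface_def)
qed

lemma partial_strip_eq:
  assumes "u \<in> I"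
  shows "at u within I \<noteq> bot \<Longrightarrow> ((\<lambda>r. X r t) has_vector_derivative d) (at u within I) \<Longrightarrow>
      partial (I \<times> UNIV) 1 X u t = d"
    and "(X u has_vector_derivative d) (at t) \<Longrightarrow> partial (I \<times> UNIV) 2 X u t = d"
  using assms by (auto simp: partial_def intro: vector_derivative_within vector_derivative_at)

lemma C1_surface_stripI:
  assumes nt: "\<And>u. u \<in> I \<Longrightarrow> at u within I \<noteq> bot"
    and du: "\<And>u t. u \<in> I \<Longrightarrow> ((\<lambda>r. X r t) has_vector_derivative Xu u t) (at u within I)"
    and dt: "\<And>u t. u \<in> I \<Longrightarrow> (X u has_vector_derivative Xt u t) (at t)"
    and cont: "continuous_on (I \<times> UNIV) (\<lambda>(u, t). X u t)"
      "continuous_on (I \<times> UNIV) (\<lambda>(u, t). Xu u t)"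
      "continuous_on (I \<times> UNIV) (\<lambda>(u, t). Xt u t)"
  shows "C1_surface (I \<times> UNIV) X"
proof -
  have "continuous_on (I \<times> UNIV) (\<lambda>(u, t). partial (I \<times> UNIV) 1 X u t)"
    using cont(2) partial_strip_eq(1)[OF _ nt du]
    by (subst continuous_on_cong[OF refl, where g = "\<lambda>(u, t). Xu u t"]) auto
  moreover have "continuous_on (I \<times> UNIV) (\<lambda>(u, t). partial (I \<times> UNIV) 2 X u t)"
    using cont(3) partial_strip_eq(2)[OF _ dt]
    by (subst continuous_on_cong[OF refl, where g = "\<lambda>(u, t). Xt u t"]) auto
  moreover have "has_partial (I \<times> UNIV) i X u t" if "u \<in> I" for i u t
    using that du[OF that] dt[OF that]
    by (auto simp: has_partial_def intro: differentiableI_vector)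
  ultimately show ?thesis
    using cont(1) by (auto simp: C1_surface_def forall_2)
qed


section \<open>Mean curvature of hyperbolic screw surfaces\<close>

definition hyperbolic_screw ::
  "(real \<Rightarrow> real) \<Rightarrow> (real \<Rightarrow> real) \<Rightarrow> real \<Rightarrow> (real \<Rightarrow> real) \<Rightarrow> real \<Rightarrow> real \<Rightarrow> real^3" where
  "hyperbolic_screw p q c z u t = vector [u * p t, u * q t, z u + c * t]"

context
  fixes p q :: "real \<Rightarrow> real" and \<phi> \<epsilon> c :: real and z z' z'' :: "real \<Rightarrow> real" and I :: "real set"
  assumes dp: "\<And>t. (p has_real_derivative \<phi> * q t) (at t)"
    and dq: "\<And>t. (q has_real_derivative \<phi> * p t) (at t)"
    and pq: "\<And>t. (p t)\<^sup>2 - (q t)\<^sup>2 = \<epsilon>"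
    and nontrivial: "\<And>u. u \<in> I \<Longrightarrow> at u within I \<noteq> bot"
    and dz: "\<And>u. u \<in> I \<Longrightarrow> (z has_real_derivative z' u) (at u within I)"
    and dz': "\<And>u. u \<in> I \<Longrightarrow> (z' has_real_derivative z'' u) (at u within I)"
    and cont_z'': "continuous_on I z''"
begin

private abbreviation (input) "X \<equiv> hyperbolic_screw p q c z"
private abbreviation (input) "Xu \<equiv> (\<lambda>u t. vector [p t, q t, z' u] :: real^3)"
private abbreviation (input) "Xt \<equiv> (\<lambda>u t. vector [u * (\<phi> * q t), u * (\<phi> * p t), c] :: real^3)"
private abbreviation (input) "Xuu \<equiv> (\<lambda>u t. vector [0, 0, z'' u] :: real^3)"
private abbreviation (input) "Xut \<equiv> (\<lambda>u t. vector [\<phi> * q t, \<phi> * p t, 0] :: real^3)"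
private abbreviation (input) "Xtt \<equiv> (\<lambda>u t. vector [u * \<phi>\<^sup>2 * p t, u * \<phi>\<^sup>2 * q t, 0] :: real^3)"

lemma screw_derivatives:
  assumes "u \<in> I"
  shows "((\<lambda>r. X r t) has_vector_derivative Xu u t) (at u within I)"
    and "(X u has_vector_derivative Xt u t) (at t)"
    and "((\<lambda>r. Xu r t) has_vector_derivative Xuu u t) (at u within I)"
    and "(Xu u has_vector_derivative Xut u t) (at t)"
    and "((\<lambda>r. Xt r t) has_vector_derivative Xut u t) (at u within I)"
    and "(Xt u has_vector_derivative Xtt u t) (at t)"
  unfolding hyperbolic_screw_def
  by (rule has_vector_derivative_vector_3;
      auto intro!: derivative_eq_intros dp dq dz dz' assms simp: power2_eq_square)+

lemma screw_continuous:
  shows "continuous_on (I \<times> UNIV) (\<lambda>(u, t). X u t)"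
    and "continuous_on (I \<times> UNIV) (\<lambda>(u, t). Xu u t)"
    and "continuous_on (I \<times> UNIV) (\<lambda>(u, t). Xt u t)"
    and "continuous_on (I \<times> UNIV) (\<lambda>(u, t). Xuu u t)"
    and "continuous_on (I \<times> UNIV) (\<lambda>(u, t). Xut u t)"
    and "continuous_on (I \<times> UNIV) (\<lambda>(u, t). Xtt u t)"
proof -
  have lift_u: "continuous_on (I \<times> UNIV) (\<lambda>x. f (fst x))" if "continuous_on I f"
    for f :: "real \<Rightarrow> real"
    by (rule continuous_on_compose2[OF that]) (auto intro: continuous_intros)
  have lift_t: "continuous_on (I \<times> UNIV) (\<lambda>x. f (snd x))" if "continuous_on UNIV f"
    for f :: "real \<Rightarrow> real"
    by (rule continuous_on_compose2[OF that]) (auto intro: continuous_intros)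
  note base = lift_u[OF DERIV_continuous_on[OF dz]] lift_u[OF DERIV_continuous_on[OF dz']]
    lift_u[OF cont_z''] lift_t[OF DERIV_continuous_on[OF dp]] lift_t[OF DERIV_continuous_on[OF dq]]
  show "continuous_on (I \<times> UNIV) (\<lambda>(u, t). X u t)"
    "continuous_on (I \<times> UNIV) (\<lambda>(u, t). Xu u t)"
    "continuous_on (I \<times> UNIV) (\<lambda>(u, t). Xt u t)"
    "continuous_on (I \<times> UNIV) (\<lambda>(u, t). Xuu u t)"
    "continuous_on (I \<times> UNIV) (\<lambda>(u, t). Xut u t)"
    "continuous_on (I \<times> UNIV) (\<lambda>(u, t). Xtt u t)"
    unfolding hyperbolic_screw_def case_prod_beta
    by (intro continuous_intros base; simp)+
qed

lemma screw_partials: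
  assumes "u \<in> I"
  shows "partial (I \<times> UNIV) 1 X u t = Xu u t"
    and "partial (I \<times> UNIV) 2 X u t = Xt u t"
    and "partial (I \<times> UNIV) 1 (partial (I \<times> UNIV) 1 X) u t = Xuu u t"
    and "partial (I \<times> UNIV) 2 (partial (I \<times> UNIV) 1 X) u t = Xut u t"
    and "partial (I \<times> UNIV) 2 (partial (I \<times> UNIV) 2 X) u t = Xtt u t"
proof -
  have 1: "partial (I \<times> UNIV) 1 X u t = Xu u t" if "u \<in> I" for u t
    using that by (intro partial_strip_eq nontrivial screw_derivatives)
  have 2: "partial (I \<times> UNIV) 2 X u t = Xt u t" if "u \<in> I" for u t
    using that by (intro partial_strip_eq nontrivial screw_derivatives)
  show "partial (I \<times> UNIV) 1 X u t = Xu u t" "partial (I \<times> UNIV) 2 X u t = Xt u t"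
    using 1 2 assms by auto
  show "partial (I \<times> UNIV) 1 (partial (I \<times> UNIV) 1 X) u t = Xuu u t"
    using partial_strip_cong(1)[of I "partial (I \<times> UNIV) 1 X" Xu u 1 t] 1 assms
      partial_strip_eq(1)[where X = Xu, OF assms nontrivial[OF assms] screw_derivatives(3)[OF assms]] by simp
  show "partial (I \<times> UNIV) 2 (partial (I \<times> UNIV) 1 X) u t = Xut u t"
    using partial_strip_cong(1)[of I "partial (I \<times> UNIV) 1 X" Xu u 2 t] 1 assms
      partial_strip_eq(2)[where X = Xu, OF assms screw_derivatives(4)[OF assms]] by simp
  show "partial (I \<times> UNIV) 2 (partial (I \<times> UNIV) 2 X) u t = Xtt u t"
    using partial_strip_cong(1)[of I "partial (I \<times> UNIV) 2 X" Xt u 2 t] 2 assms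
      partial_strip_eq(2)[where X = Xt, OF assms screw_derivatives(6)[OF assms]] by simp
qed

lemma C2_surface_hyperbolic_screw: "C2_surface (I \<times> UNIV) X"
proof -
  have "C1_surface (I \<times> UNIV) X"
    by (rule C1_surface_stripI[OF nontrivial screw_derivatives(1,2) screw_continuous(1,2,3)])
  moreover have "C1_surface (I \<times> UNIV) (partial (I \<times> UNIV) 1 X)"
    using C1_surface_stripI[OF nontrivial screw_derivatives(3,4) screw_continuous(2,4,5)]
      C1_surface_strip_cong[OF screw_partials(1)] by simp
  moreover have "C1_surface (I \<times> UNIV) (partial (I \<times> UNIV) 2 X)"
    using C1_surface_stripI[OF nontrivial screw_derivatives(5,6) screw_continuous(3,5,6)]
      C1_surface_strip_cong[OF screw_partials(2)] by simp
  ultimately show ?thesis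
    by (simp add: C2_surface_def forall_2)
qed

text \<open>The minor is the hyperbolic determinant \<open>\<phi> u (p\<^sup>2 - q\<^sup>2)\<close>, free of \<open>t\<close>.\<close>

lemma X_minor_12_hyperbolic_screw:
  assumes "u \<in> I"
  shows "X_minor (I \<times> UNIV) X 1 2 u t = \<epsilon> * \<phi> * u"
  unfolding X_minor_def screw_partials[OF assms] pq[of t, symmetric]
  by (simp add: algebra_simps power2_eq_square)

lemma admissible_hyperbolic_screw:
  assumes "\<phi> \<noteq> 0" "\<epsilon> \<noteq> 0" "0 \<notin> I"
  shows "admissible (I \<times> UNIV) X"
  using assms by (auto simp: admissible_def X_minor_12_hyperbolic_screw)

text \<open>
  The pairing of \<open>N\<^sub>h\<close> with the radial direction \<open>(p, q)\<close> occurring in \<open>h\<^sub>2\<^sub>2\<close> cancels the terms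
  in \<open>c\<close>, which is why the pitch does not influence the mean curvature.
\<close>

lemma mean_curvature_hyperbolic_screw:
  assumes "\<phi> \<noteq> 0" "\<epsilon>\<^sup>2 = 1" "u \<noteq> 0" "u \<in> I"
  shows "mean_curvature (I \<times> UNIV) X u t = \<epsilon> * (z'' u + z' u / u) / 2"
proof -
  let ?U = "I \<times> (UNIV :: real set)"
  let ?A = "(q t * c - z' u * (u * (\<phi> * p t))) / (\<epsilon> * \<phi> * u)"
  let ?B = "(p t * c - z' u * (u * (\<phi> * q t))) / (\<epsilon> * \<phi> * u)"
  note P = screw_partials[OF assms(4)]
  have \<epsilon>: "\<epsilon> \<noteq> 0"
    using assms(2) by auto
  have N: "N_h ?U X u t = vector [?A, ?B, 1]"
    unfolding N_h_def X_minor_12_hyperbolic_screw[OF assms(4)] by (simp add: X_minor_def P)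
  have g11: "g_form ?U X 1 1 u t = \<epsilon>"
    using pq[of t] by (simp add: g_form_def P pz_inner_def power2_eq_square)
  have g12: "g_form ?U X 1 2 u t = 0"
    by (simp add: g_form_def P pz_inner_def)
  have g22: "g_form ?U X 2 2 u t = - \<epsilon> * \<phi>\<^sup>2 * u\<^sup>2"
    unfolding pq[of t, symmetric] g_form_def P pz_inner_def
    by (simp add: algebra_simps power2_eq_square)
  have h11: "h_form ?U X 1 1 u t = z'' u"
    by (simp add: h_form_def P N inner_1_def)
  have "h_form ?U X 2 2 u t = (u * \<phi>\<^sup>2) * (?A * p t - ?B * q t)"
    by (simp add: h_form_def P N inner_1_def algebra_simps)
  also have "?A * p t - ?B * q t = - (z' u * u * \<phi> * ((p t)\<^sup>2 - (q t)\<^sup>2)) / (\<epsilon> * \<phi> * u)"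
    by (simp add: diff_divide_distrib [symmetric] algebra_simps power2_eq_square)
  also have "\<dots> = - z' u"
    using assms \<epsilon> by (simp add: pq)
  finally have h22: "h_form ?U X 2 2 u t = - u * \<phi>\<^sup>2 * z' u"
    by simp
  have "mean_curvature ?U X u t =
      (\<epsilon> * \<phi>\<^sup>2 * u\<^sup>2) * (z'' u + z' u / u) / ((\<epsilon> * \<phi>\<^sup>2 * u\<^sup>2) * \<epsilon>) / 2"
    unfolding mean_curvature_def g11 g12 g22 h11 h22
    using assms(1,3) \<epsilon> by (simp add: field_simps power2_eq_square)
  also have "\<dots> = (z'' u + z' u / u) / \<epsilon> / 2"
    using assms(1,3) \<epsilon> by simp
  also have "1 / \<epsilon> = \<epsilon>"
    using assms(2) \<epsilon> by (simp add: field_simps power2_eq_square)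
  then have "(z'' u + z' u / u) / \<epsilon> / 2 = \<epsilon> * (z'' u + z' u / u) / 2"
    by (metis mult.commute times_divide_eq_right mult.right_neutral)
  finally show ?thesis .
qed

end


section \<open>The profile with prescribed mean curvature\<close>

text \<open>
  The derivative may be one-sided, so the point is enclosed in a compact subinterval that is a
  neighbourhood of it relative to \<open>I\<close>.
\<close>

lemma has_real_derivative_integral_on_interval:
  fixes f :: "real \<Rightarrow> real"
  assumes I: "is_interval I" and a: "a \<in> I" and x: "x \<in> I" and f: "continuous_on I f"
  shows "((\<lambda>u. LBINT y=a..u. f y) has_real_derivative f x) (at x within I)"
proof -
  have "\<exists>l\<in>I. l \<le> x \<and> l \<le> a \<and> (l < x \<or> (\<forall>y\<in>I. x \<le> y))"
  proof (cases "\<exists>y\<in>I. y < x")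
    case True
    then obtain y where "y \<in> I" "y < x" by auto
    then show ?thesis using a by (intro bexI[of _ "min y a"]) (auto simp: min_def)
  next
    case False
    then have "\<forall>y\<in>I. x \<le> y" by (simp add: not_less)
    then show ?thesis using a x by blast
  qed
  then obtain l where l: "l \<in> I" "l \<le> x" "l \<le> a" "l < x \<or> (\<forall>y\<in>I. x \<le> y)"
    by blast
  have "\<exists>r\<in>I. x \<le> r \<and> a \<le> r \<and> (x < r \<or> (\<forall>y\<in>I. y \<le> x))"
  proof (cases "\<exists>y\<in>I. x < y")
    case True
    then obtain y where "y \<in> I" "x < y" by auto
    then show ?thesis using a by (intro bexI[of _ "max y a"]) (auto simp: max_def)
  next
    case False
    then have "\<forall>y\<in>I. y \<le> x" by (simp add: not_less)
    then show ?thesis using a x by blast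
  qed
  then obtain r where r: "r \<in> I" "x \<le> r" "a \<le> r" "x < r \<or> (\<forall>y\<in>I. y \<le> x)"
    by blast
  have sub: "{l..r} \<subseteq> I"
    using mem_is_interval_1_I[OF I l(1) r(1)] by auto
  have "((\<lambda>u. LBINT y=a..u. f y) has_vector_derivative f x) (at x within {l..r})"
    using l r continuous_on_subset[OF f sub] by (intro interval_integral_FTC2) auto
  \<comment> \<open>Where \<open>l = x\<close> (or \<open>r = x\<close>) the interval \<open>I\<close> has no points beyond \<open>x\<close> on that side, so there
    the open neighbourhood may exceed \<open>{l..r}\<close>.\<close>
  moreover have "at x within {l..r} = at x within I"
  proof (rule at_within_nhd)
    let ?S = "{(if l = x then x - 1 else l)<..<(if r = x then x + 1 else r)}"
    show "x \<in> ?S" "open ?S" using l r by auto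
    show "{l..r} \<inter> ?S - {x} = I \<inter> ?S - {x}"
    proof
      show "{l..r} \<inter> ?S - {x} \<subseteq> I \<inter> ?S - {x}" using sub by auto
      show "I \<inter> ?S - {x} \<subseteq> {l..r} \<inter> ?S - {x}"
        using l(2,4) r(2,4) by (force split: if_splits)
    qed
  qed
  ultimately show ?thesis
    by (simp add: has_real_derivative_iff_has_vector_derivative)
qed

definition moment :: "real \<Rightarrow> (real \<Rightarrow> real) \<Rightarrow> real \<Rightarrow> real" where
  "moment s\<^sub>0 H s = (LBINT w=s\<^sub>0..s. w * H w)"

definition profile ::
  "real \<Rightarrow> real \<Rightarrow> (real \<Rightarrow> real) \<Rightarrow> real \<Rightarrow> real \<Rightarrow> real \<Rightarrow> real" where
  "profile \<epsilon> s\<^sub>0 H h\<^sub>0 h\<^sub>1 s = h\<^sub>0 + h\<^sub>1 * ln s + \<epsilon> * (LBINT v=s\<^sub>0..s. 2 / v * moment s\<^sub>0 H v)"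

definition profile_deriv ::
  "real \<Rightarrow> real \<Rightarrow> (real \<Rightarrow> real) \<Rightarrow> real \<Rightarrow> real \<Rightarrow> real" where
  "profile_deriv \<epsilon> s\<^sub>0 H h\<^sub>1 s = (h\<^sub>1 + 2 * \<epsilon> * moment s\<^sub>0 H s) / s"

text \<open>Read off from the differential equation \<open>z'' + z' / s = 2 \<epsilon> H\<close>.\<close>

definition profile_deriv2 ::
  "real \<Rightarrow> real \<Rightarrow> (real \<Rightarrow> real) \<Rightarrow> real \<Rightarrow> real \<Rightarrow> real" where
  "profile_deriv2 \<epsilon> s\<^sub>0 H h\<^sub>1 s = 2 * \<epsilon> * H s - profile_deriv \<epsilon> s\<^sub>0 H h\<^sub>1 s / s"

context
  fixes I :: "real set" and s\<^sub>0 :: real and H :: "real \<Rightarrow> real"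
  assumes I: "is_interval I" "interior I \<noteq> {}" and pos: "I \<subseteq> {0<..}" and s\<^sub>0: "s\<^sub>0 \<in> I"
    and H: "continuous_on I H"
begin

lemma moment_has_derivative:
  assumes "s \<in> I"
  shows "(moment s\<^sub>0 H has_real_derivative s * H s) (at s within I)"
  unfolding moment_def
  by (intro has_real_derivative_integral_on_interval I s\<^sub>0 assms continuous_intros H)

lemma continuous_on_moment: "continuous_on I (moment s\<^sub>0 H)"
  by (rule DERIV_continuous_on[OF moment_has_derivative])

lemma profile_has_derivative:
  assumes "s \<in> I"
  shows "(profile \<epsilon> s\<^sub>0 H h\<^sub>0 h\<^sub>1 has_real_derivative profile_deriv \<epsilon> s\<^sub>0 H h\<^sub>1 s) (at s within I)"
proof -
  have s: "s > 0"
    using assms pos by auto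
  have "continuous_on I (\<lambda>v. 2 / v * moment s\<^sub>0 H v)"
    using pos by (intro continuous_intros continuous_on_moment) auto
  from has_real_derivative_integral_on_interval[OF I(1) s\<^sub>0 assms this]
  have "((\<lambda>s. LBINT v=s\<^sub>0..s. 2 / v * moment s\<^sub>0 H v) has_real_derivative
      2 / s * moment s\<^sub>0 H s) (at s within I)" .
  moreover have "(ln has_real_derivative 1 / s) (at s within I)"
    using s by (auto intro!: derivative_eq_intros)
  ultimately have "(profile \<epsilon> s\<^sub>0 H h\<^sub>0 h\<^sub>1 has_real_derivative
      0 + h\<^sub>1 * (1 / s) + \<epsilon> * (2 / s * moment s\<^sub>0 H s)) (at s within I)"
    unfolding profile_def [abs_def] by (intro DERIV_add DERIV_cmult DERIV_const)
  moreover have "0 + h\<^sub>1 * (1 / s) + \<epsilon> * (2 / s * moment s\<^sub>0 H s) = profile_deriv \<epsilon> s\<^sub>0 H h\<^sub>1 s"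
    by (simp add: profile_deriv_def add_divide_distrib)
  ultimately show ?thesis
    by simp
qed

lemma profile_deriv_has_derivative:
  assumes "s \<in> I"
  shows "(profile_deriv \<epsilon> s\<^sub>0 H h\<^sub>1 has_real_derivative profile_deriv2 \<epsilon> s\<^sub>0 H h\<^sub>1 s) (at s within I)"
proof -
  have s: "s > 0"
    using assms pos by auto
  have "((\<lambda>s. h\<^sub>1 + 2 * \<epsilon> * moment s\<^sub>0 H s) has_real_derivative 0 + 2 * \<epsilon> * (s * H s))
      (at s within I)"
    by (intro DERIV_add DERIV_cmult DERIV_const moment_has_derivative assms)
  from DERIV_divide[OF this DERIV_ident] s
  have "(profile_deriv \<epsilon> s\<^sub>0 H h\<^sub>1 has_real_derivative
      ((0 + 2 * \<epsilon> * (s * H s)) * s - (h\<^sub>1 + 2 * \<epsilon> * moment s\<^sub>0 H s) * 1) / (s * s)) (at s within I)"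
    unfolding profile_deriv_def [abs_def] by simp
  moreover have "((0 + 2 * \<epsilon> * (s * H s)) * s - (h\<^sub>1 + 2 * \<epsilon> * moment s\<^sub>0 H s) * 1) / (s * s) =
      profile_deriv2 \<epsilon> s\<^sub>0 H h\<^sub>1 s"
    using s by (simp add: profile_deriv_def profile_deriv2_def field_simps)
  ultimately show ?thesis
    by simp
qed

lemma continuous_on_profile_deriv2: "continuous_on I (profile_deriv2 \<epsilon> s\<^sub>0 H h\<^sub>1)"
  unfolding profile_deriv2_def profile_deriv_def
  using pos by (intro continuous_intros continuous_on_moment H) auto

lemma profile_initial_values:
  shows "profile \<epsilon> s\<^sub>0 H h\<^sub>0 h\<^sub>1 s\<^sub>0 = h\<^sub>0 + h\<^sub>1 * ln s\<^sub>0"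
    and "curve_deriv I (profile \<epsilon> s\<^sub>0 H h\<^sub>0 h\<^sub>1) s\<^sub>0 = h\<^sub>1 / s\<^sub>0"
proof -
  show "profile \<epsilon> s\<^sub>0 H h\<^sub>0 h\<^sub>1 s\<^sub>0 = h\<^sub>0 + h\<^sub>1 * ln s\<^sub>0"
    by (simp add: profile_def)
  have "curve_deriv I (profile \<epsilon> s\<^sub>0 H h\<^sub>0 h\<^sub>1) s\<^sub>0 = profile_deriv \<epsilon> s\<^sub>0 H h\<^sub>1 s\<^sub>0"
    using interval_at_within_nontrivial[OF I s\<^sub>0] profile_has_derivative[OF s\<^sub>0]
    by (intro curve_deriv_eq) (auto simp: has_real_derivative_iff_has_vector_derivative)
  then show "curve_deriv I (profile \<epsilon> s\<^sub>0 H h\<^sub>0 h\<^sub>1) s\<^sub>0 = h\<^sub>1 / s\<^sub>0"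
    by (simp add: profile_deriv_def moment_def)
qed

text \<open>
  With slopes \<open>(a, b) = (1, 0)\<close> or \<open>(0, 1)\<close> these are the two kinds of generating curve.  The
  degenerate metric ignores \<open>z\<close>, so \<open>s\<close> is an arc length whatever the profile is.
\<close>

lemma profile_curve:
  fixes a b \<epsilon> h\<^sub>0 h\<^sub>1 :: real
  defines "\<alpha> \<equiv> (\<lambda>s. vector [a * s, b * s, profile \<epsilon> s\<^sub>0 H h\<^sub>0 h\<^sub>1 s] :: real^3)"
  shows "C2_curve I \<alpha>"
    and "s \<in> I \<Longrightarrow> pz_inner (curve_deriv I \<alpha> s) (curve_deriv I \<alpha> s) = a\<^sup>2 - b\<^sup>2"
proof -
  note nt = interval_at_within_nontrivial[OF I]
  have d1: "(\<alpha> has_vector_derivative vector [a, b, profile_deriv \<epsilon> s\<^sub>0 H h\<^sub>1 s]) (at s within I)"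
    if "s \<in> I" for s
    unfolding \<alpha>_def using that
    by (intro has_vector_derivative_vector_3 profile_has_derivative)
      (auto intro!: derivative_eq_intros)
  have d2: "((\<lambda>s. vector [a, b, profile_deriv \<epsilon> s\<^sub>0 H h\<^sub>1 s] :: real^3) has_vector_derivative
      vector [0, 0, profile_deriv2 \<epsilon> s\<^sub>0 H h\<^sub>1 s]) (at s within I)"
    if "s \<in> I" for s
    using that by (intro has_vector_derivative_vector_3 profile_deriv_has_derivative) auto
  show "C2_curve I \<alpha>"
    by (rule C2_curveI[OF nt d1 d2])
      (auto intro!: continuous_intros continuous_on_profile_deriv2)
  show "pz_inner (curve_deriv I \<alpha> s) (curve_deriv I \<alpha> s) = a\<^sup>2 - b\<^sup>2" if "s \<in> I"
    using curve_deriv_eq[OF nt[OF that] d1[OF that]]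
    by (simp add: pz_inner_def power2_eq_square)
qed

lemma profile_surface:
  fixes p q :: "real \<Rightarrow> real" and \<phi> \<epsilon> c h\<^sub>0 h\<^sub>1 :: real
  assumes "\<And>t. (p has_real_derivative \<phi> * q t) (at t)"
    and "\<And>t. (q has_real_derivative \<phi> * p t) (at t)"
    and "\<And>t. (p t)\<^sup>2 - (q t)\<^sup>2 = \<epsilon>"
    and "\<phi> \<noteq> 0" "\<epsilon>\<^sup>2 = 1"
  defines "X \<equiv> hyperbolic_screw p q c (profile \<epsilon> s\<^sub>0 H h\<^sub>0 h\<^sub>1)"
  shows "C2_surface (I \<times> UNIV) X"
    and "admissible (I \<times> UNIV) X"
    and "s \<in> I \<Longrightarrow> mean_curvature (I \<times> UNIV) X s t = H s"
proof -
  note screw = assms(1-3) interval_at_within_nontrivial[OF I]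
    profile_has_derivative[where \<epsilon> = \<epsilon>] profile_deriv_has_derivative continuous_on_profile_deriv2
  have "\<epsilon> \<noteq> 0" "0 \<notin> I"
    using assms(5) pos by auto
  show "C2_surface (I \<times> UNIV) X"
    unfolding X_def by (rule C2_surface_hyperbolic_screw[OF screw])
  show "admissible (I \<times> UNIV) X"
    unfolding X_def
    by (rule admissible_hyperbolic_screw[OF screw \<open>\<phi> \<noteq> 0\<close> \<open>\<epsilon> \<noteq> 0\<close> \<open>0 \<notin> I\<close>])
  assume s: "s \<in> I"
  then have "s \<noteq> 0"
    using \<open>0 \<notin> I\<close> by auto
  have "mean_curvature (I \<times> UNIV) X s t =
      \<epsilon> * (profile_deriv2 \<epsilon> s\<^sub>0 H h\<^sub>1 s + profile_deriv \<epsilon> s\<^sub>0 H h\<^sub>1 s / s) / 2"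
    unfolding X_def
    by (rule mean_curvature_hyperbolic_screw[OF screw \<open>\<phi> \<noteq> 0\<close> \<open>\<epsilon>\<^sup>2 = 1\<close> \<open>s \<noteq> 0\<close> s])
  also have "\<dots> = \<epsilon>\<^sup>2 * H s"
    by (simp add: profile_deriv2_def power2_eq_square)
  finally show "mean_curvature (I \<times> UNIV) X s t = H s"
    using \<open>\<epsilon>\<^sup>2 = 1\<close> by simp
qed

end


section \<open>Helicoidal surfaces with prescribed mean curvature\<close>

lemma Zh2_eq_hyperbolic_screw:
  "Zh2 c \<phi> (\<lambda>s. vector [s, 0, z s]) =
     hyperbolic_screw (\<lambda>t. cosh (t * \<phi>)) (\<lambda>t. sinh (t * \<phi>)) c z"
  by (simp add: Zh2_def hyperbolic_screw_def fun_eq_iff)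

lemma Wh2_eq_hyperbolic_screw:
  "Wh2 c \<phi> (\<lambda>s. vector [0, s, z s]) =
     hyperbolic_screw (\<lambda>t. sinh (t * \<phi>)) (\<lambda>t. cosh (t * \<phi>)) c z"
  by (simp add: Wh2_def hyperbolic_screw_def fun_eq_iff)

theorem theorem6p4:
  fixes c \<phi> s\<^sub>0 :: real and H :: "real \<Rightarrow> real" and I :: "real set"
  assumes "\<phi> \<noteq> 0"
    and "is_interval I" and "interior I \<noteq> {}" and "I \<subseteq> {0<..}" and "s\<^sub>0 \<in> I"
    and "continuous_on I H"
  shows
    "(\<exists>(z :: real \<Rightarrow> real \<Rightarrow> real \<Rightarrow> real) (\<alpha> :: real \<Rightarrow> real \<Rightarrow> real \<Rightarrow> real^3)
       (X :: real \<Rightarrow> real \<Rightarrow> real \<Rightarrow> real \<Rightarrow> real^3) (d\<^sub>0 :: real \<Rightarrow> real \<Rightarrow> real) (d\<^sub>1 :: real \<Rightarrow> real \<Rightarrow> real).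
       \<forall>h\<^sub>0 h\<^sub>1.
         spacelike_helicoidal c \<phi> I (\<alpha> h\<^sub>0 h\<^sub>1) (X h\<^sub>0 h\<^sub>1) \<and>
         arc_length_parametrized_on I (\<alpha> h\<^sub>0 h\<^sub>1) \<and>
         (\<forall>s\<in>I. \<forall>t. mean_curvature (I \<times> UNIV) (X h\<^sub>0 h\<^sub>1) s t = H s) \<and>
         (\<forall>s\<in>I. \<alpha> h\<^sub>0 h\<^sub>1 s = vector [s, 0, z h\<^sub>0 h\<^sub>1 s]) \<and>
         (\<forall>s\<in>I. z h\<^sub>0 h\<^sub>1 s = h\<^sub>0 + h\<^sub>1 * ln s
            + (1::real) * (LBINT v=s\<^sub>0..s. 2 / v * (LBINT w=s\<^sub>0..v. w * H w))) \<and>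
         h\<^sub>0 = d\<^sub>0 (z h\<^sub>0 h\<^sub>1 s\<^sub>0) (curve_deriv I (z h\<^sub>0 h\<^sub>1) s\<^sub>0) \<and>
         h\<^sub>1 = d\<^sub>1 (z h\<^sub>0 h\<^sub>1 s\<^sub>0) (curve_deriv I (z h\<^sub>0 h\<^sub>1) s\<^sub>0))
     \<and>
     (\<exists>(z :: real \<Rightarrow> real \<Rightarrow> real \<Rightarrow> real) (\<alpha> :: real \<Rightarrow> real \<Rightarrow> real \<Rightarrow> real^3)
       (X :: real \<Rightarrow> real \<Rightarrow> real \<Rightarrow> real \<Rightarrow> real^3) (d\<^sub>0 :: real \<Rightarrow> real \<Rightarrow> real) (d\<^sub>1 :: real \<Rightarrow> real \<Rightarrow> real).
       \<forall>h\<^sub>0 h\<^sub>1.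
         timelike_helicoidal c \<phi> I (\<alpha> h\<^sub>0 h\<^sub>1) (X h\<^sub>0 h\<^sub>1) \<and>
         arc_length_parametrized_on I (\<alpha> h\<^sub>0 h\<^sub>1) \<and>
         (\<forall>s\<in>I. \<forall>t. mean_curvature (I \<times> UNIV) (X h\<^sub>0 h\<^sub>1) s t = H s) \<and>
         (\<forall>s\<in>I. \<alpha> h\<^sub>0 h\<^sub>1 s = vector [0, s, z h\<^sub>0 h\<^sub>1 s]) \<and>
         (\<forall>s\<in>I. z h\<^sub>0 h\<^sub>1 s = h\<^sub>0 + h\<^sub>1 * ln s
            + (-1::real) * (LBINT v=s\<^sub>0..s. 2 / v * (LBINT w=s\<^sub>0..v. w * H w))) \<and>
         h\<^sub>0 = d\<^sub>0 (z h\<^sub>0 h\<^sub>1 s\<^sub>0) (curve_deriv I (z h\<^sub>0 h\<^sub>1) s\<^sub>0) \<and>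
         h\<^sub>1 = d\<^sub>1 (z h\<^sub>0 h\<^sub>1 s\<^sub>0) (curve_deriv I (z h\<^sub>0 h\<^sub>1) s\<^sub>0))"
proof -
  note profile_facts = assms(2-6)
  let ?z = "\<lambda>\<epsilon>. profile \<epsilon> s\<^sub>0 H"
  \<comment> \<open>These invert \<open>z(s\<^sub>0) = h\<^sub>0 + h\<^sub>1 ln s\<^sub>0\<close> and \<open>z'(s\<^sub>0) = h\<^sub>1 / s\<^sub>0\<close>.\<close>
  let ?d\<^sub>0 = "\<lambda>z\<^sub>0 z\<^sub>1. z\<^sub>0 - s\<^sub>0 * z\<^sub>1 * ln s\<^sub>0" and ?d\<^sub>1 = "\<lambda>z\<^sub>0 z\<^sub>1 :: real. s\<^sub>0 * z\<^sub>1"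
  have "s\<^sub>0 \<noteq> 0"
    using assms(4,5) by auto
  then have initial: "h\<^sub>0 = ?d\<^sub>0 (?z \<epsilon> h\<^sub>0 h\<^sub>1 s\<^sub>0) (curve_deriv I (?z \<epsilon> h\<^sub>0 h\<^sub>1) s\<^sub>0)"
    "h\<^sub>1 = ?d\<^sub>1 (?z \<epsilon> h\<^sub>0 h\<^sub>1 s\<^sub>0) (curve_deriv I (?z \<epsilon> h\<^sub>0 h\<^sub>1) s\<^sub>0)" for \<epsilon> h\<^sub>0 h\<^sub>1
    by (simp_all add: profile_initial_values[OF profile_facts])
  have dcosh: "((\<lambda>t. cosh (t * \<phi>)) has_real_derivative \<phi> * sinh (t * \<phi>)) (at t)" for t
    by (auto intro!: derivative_eq_intros)
  have dsinh: "((\<lambda>t. sinh (t * \<phi>)) has_real_derivative \<phi> * cosh (t * \<phi>)) (at t)" for t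
    by (auto intro!: derivative_eq_intros)
  have hyp: "(cosh (t * \<phi>))\<^sup>2 - (sinh (t * \<phi>))\<^sup>2 = 1"
    "(sinh (t * \<phi>))\<^sup>2 - (cosh (t * \<phi>))\<^sup>2 = - 1" for t
    by (simp_all add: cosh_square_eq)
  let ?\<alpha>S = "\<lambda>h\<^sub>0 h\<^sub>1 s. vector [s, 0, ?z 1 h\<^sub>0 h\<^sub>1 s] :: real^3"
  let ?\<alpha>T = "\<lambda>h\<^sub>0 h\<^sub>1 s. vector [0, s, ?z (-1) h\<^sub>0 h\<^sub>1 s] :: real^3"
  note curveS = profile_curve[OF profile_facts, where a = 1 and b = 0 and \<epsilon> = 1, simplified]
  note curveT = profile_curve[OF profile_facts, where a = 0 and b = 1 and \<epsilon> = "-1", simplified]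
  note surfaceS = profile_surface[OF profile_facts dcosh dsinh hyp(1) assms(1), simplified,
      folded Zh2_eq_hyperbolic_screw]
  note surfaceT = profile_surface[OF profile_facts dsinh dcosh hyp(2) assms(1), simplified,
      folded Wh2_eq_hyperbolic_screw]
  have S: "spacelike_helicoidal c \<phi> I (?\<alpha>S h\<^sub>0 h\<^sub>1) (Zh2 c \<phi> (?\<alpha>S h\<^sub>0 h\<^sub>1))"
    "arc_length_parametrized_on I (?\<alpha>S h\<^sub>0 h\<^sub>1)" for h\<^sub>0 h\<^sub>1
    using curveS surfaceS
    by (auto simp: spacelike_helicoidal_def spacelike_on_def arc_length_parametrized_on_def)
  have T: "timelike_helicoidal c \<phi> I (?\<alpha>T h\<^sub>0 h\<^sub>1) (Wh2 c \<phi> (?\<alpha>T h\<^sub>0 h\<^sub>1))"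
    "arc_length_parametrized_on I (?\<alpha>T h\<^sub>0 h\<^sub>1)" for h\<^sub>0 h\<^sub>1
    using curveT surfaceT
    by (auto simp: timelike_helicoidal_def timelike_on_def arc_length_parametrized_on_def)
  show ?thesis
  proof (rule conjI, goal_cases)
    case 1
    show ?case
      by (rule exI[of _ "?z 1"], rule exI[of _ ?\<alpha>S],
          rule exI[of _ "\<lambda>h\<^sub>0 h\<^sub>1. Zh2 c \<phi> (?\<alpha>S h\<^sub>0 h\<^sub>1)"],
          rule exI[of _ ?d\<^sub>0], rule exI[of _ ?d\<^sub>1])
        (intro allI conjI ballI S surfaceS initial refl; simp add: profile_def moment_def)
  next
    case 2
    show ?case
      by (rule exI[of _ "?z (-1)"], rule exI[of _ ?\<alpha>T],
          rule exI[of _ "\<lambda>h\<^sub>0 h\<^sub>1. Wh2 c \<phi> (?\<alpha>T h\<^sub>0 h\<^sub>1)"],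
          rule exI[of _ ?d\<^sub>0], rule exI[of _ ?d\<^sub>1])
        (intro allI conjI ballI T surfaceT initial refl; simp add: profile_def moment_def)
  qed
qed

end
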